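(* Let $0<h_+<\infty$, let $U_+\in C^2([0,h_+])$ be real valued, and let $c_k$ be one of the two numbers $$c_k=\pm\sqrt{\frac{g+\rho_-^{-1}\sigma k^2}{|k|\tanh(|k|h_-)}} .$$ Suppose $c_k\notin U_+([0,h_+])$. Then there exists $\epsilon_k>0$ such that, if $\epsilon\in(0,\epsilon_k)$ and $(y,c)$, with $c\in\mathbb{C}$ and $y:[0,h_+]\to\mathbb{C}$, solves $$-y''+\Big(\frac{U_+''}{U_+-c}+k^2\Big)y=0\ \text{ on }(0,h_+),\qquad y(h_+)=0,\qquad y(0)=1,$$ together with $$g(1-\epsilon)+\rho_-^{-1}\sigma k^2=-\epsilon\,(U_+(0)-c)^2y'(0)+c^2|k|\tanh(|k|h_-)+\epsilon\,U_+'(0)(U_+(0)-c)+\frac{\epsilon\,c\,|k|\,U_+(0)\,(1-\tanh^2(|k|h_-))}{\tanh(|k|h_+)+\epsilon\tanh(|k|h_-)},$$ and $$|c-c_k|\le\tfrac14\min_{x_2\in[0,h_+]}|c_k-U_+(x_2)|,$$ then $c\in\mathbb{R}$.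
   Context: Fixed constants: gravity $g>0$, surface tension $\sigma\ge0$, water density $\rho_->0$, water depth $h_->0$, height of the air layer $h_+>0$, wave number $k\in\mathbb{Z}\setminus\{0\}$. $\epsilon=\rho_+/\rho_->0$ is the density ratio of air to water; all parameters other than $\epsilon$ are fixed. Primes denote $d/dx_2$. *)

theory Defs
  imports "HOL-Analysis.Analysis"
begin

text \<open>Derivative relative to \<open>S\<close>: one-sided at the endpoints when \<open>S\<close> is a closed interval.\<close>

definition D :: "real set \<Rightarrow> (real \<Rightarrow> 'a::real_normed_vector) \<Rightarrow> real \<Rightarrow> 'a" where
  "D S f x = vector_derivative f (at x within S)"

definition C2_on :: "real set \<Rightarrow> (real \<Rightarrow> 'a::real_normed_vector) \<Rightarrow> bool" where
  "C2_on S f \<longleftrightarrow>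
     f differentiable_on S \<and> D S f differentiable_on S \<and> continuous_on S (D S (D S f))"

text \<open>
  Rayleigh equation on the open interval with its boundary conditions. The solution is
  classical inside, continuous up to the boundary, and has a one-sided derivative at \<open>0\<close>,
  which enters the interface condition below. Nothing is required of \<open>y\<close> outside \<open>[0, h]\<close>.
\<close>

definition rayleigh_bvp ::
  "real \<Rightarrow> int \<Rightarrow> (real \<Rightarrow> real) \<Rightarrow> complex \<Rightarrow> (real \<Rightarrow> complex) \<Rightarrow> bool" where
  "rayleigh_bvp h k U c y \<longleftrightarrow>
     continuous_on {0..h} y \<and> C2_on {0<..<h} y \<and> y differentiable (at 0 within {0..h}) \<and>
     (\<forall>x\<in>{0<..<h}.
        - D {0<..<h} (D {0<..<h} y) x
        + (of_real (D {0..h} (D {0..h} U) x) / (of_real (U x) - c) + of_int k ^ 2) * y x = 0) \<and>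
     y h = 0 \<and> y 0 = 1"

text \<open>Here \<open>hm\<close>, \<open>hp\<close>, \<open>rhom\<close> are the water depth, the air height and the water density.\<close>

definition interface_condition ::
  "real \<Rightarrow> real \<Rightarrow> real \<Rightarrow> real \<Rightarrow> real \<Rightarrow> int \<Rightarrow> (real \<Rightarrow> real) \<Rightarrow> real \<Rightarrow> complex \<Rightarrow>
   (real \<Rightarrow> complex) \<Rightarrow> bool" where
  "interface_condition g \<sigma> rhom hm hp k U \<epsilon> c y \<longleftrightarrow>
     (let \<kappa> = \<bar>real_of_int k\<bar> in
        of_real (g * (1 - \<epsilon>) + \<sigma> * \<kappa>\<^sup>2 / rhom) =
          - of_real \<epsilon> * (of_real (U 0) - c)\<^sup>2 * D {0..hp} y 0
          + c\<^sup>2 * of_real (\<kappa> * tanh (\<kappa> * hm))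
          + of_real (\<epsilon> * D {0..hp} U 0) * (of_real (U 0) - c)
          + of_real \<epsilon> * c * of_real (\<kappa> * U 0 * (1 - (tanh (\<kappa> * hm))\<^sup>2))
              / of_real (tanh (\<kappa> * hp) + \<epsilon> * tanh (\<kappa> * hm)))"

end

theory Submission
  imports Defs
begin

text \<open>
  Put \<open>W = (U(0) - c) y / (U - c)\<close>. Rayleigh's equation becomes the divergence-form equation
  \<open>((U - c)\<^sup>2 W')' = k\<^sup>2 (U - c)\<^sup>2 W\<close> with \<open>W(0) = 1\<close> and \<open>W(h) = 0\<close>, and the two terms of the
  interface condition that involve \<open>y'(0)\<close> and \<open>U'(0)\<close> add up to \<open>\<epsilon> F\<close>, where
  \<open>F = -(U(0) - c)\<^sup>2 W'(0) = \<integral> (U - c)\<^sup>2 (\<bar>W'\<bar>\<^sup>2 + k\<^sup>2 \<bar>W\<bar>\<^sup>2)\<close>.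
  Near \<open>c\<^sub>k\<close> the real part of \<open>(U - c)\<^sup>2\<close> is bounded below, so testing the equation with
  \<open>1 - x/h\<close> bounds the energy of \<open>W\<close> uniformly in \<open>c\<close>. Therefore \<open>F = O(1)\<close> and
  \<open>Im F = O(Im c)\<close>. The real part of the interface condition then keeps \<open>Re c\<close> away from \<open>0\<close> for
  small \<open>\<epsilon>\<close>, and its imaginary part has the form \<open>(2 \<kappa> tanh(\<kappa> h\<^sub>-) Re c + O(\<epsilon>)) Im c = 0\<close>.
\<close>

section \<open>Regularity of solutions up to the boundary\<close>

text \<open>The Rayleigh problem provides second derivatives only inside the interval, whereas the
  energy argument integrates by parts up to both endpoints. Since \<open>f\<close> is continuous on
  the closed interval, integrating it twice recovers \<open>y\<close> together with its one-sided
  derivatives.\<close>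

lemma derivatives_extend_to_closed_interval:
  fixes y y' f :: "real \<Rightarrow> 'a::banach"
  assumes "a < b" and "continuous_on {a..b} y" and f: "continuous_on {a..b} f"
    and y': "\<And>x. x \<in> {a<..<b} \<Longrightarrow> (y has_vector_derivative y' x) (at x)"
    and y'': "\<And>x. x \<in> {a<..<b} \<Longrightarrow> (y' has_vector_derivative f x) (at x)"
  obtains z where
    "\<And>x. x \<in> {a..b} \<Longrightarrow> (y has_vector_derivative z x) (at x within {a..b})"
    "\<And>x. x \<in> {a..b} \<Longrightarrow> (z has_vector_derivative f x) (at x within {a..b})"
proof -
  have at_open: "(u has_vector_derivative v) (at x within {a<..<b})"
    if "x \<in> {a<..<b}" "(u has_vector_derivative v) (at x within {a..b})"
    for u :: "real \<Rightarrow> 'a" and v x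
    using that(2) by (rule has_vector_derivative_within_subset) auto
  \<comment> \<open>The antiderivative \<open>F\<close> lives on the closed interval and differs
    from \<open>y'\<close> by a constant inside, so \<open>C + F\<close> extends \<open>y'\<close>
    continuously to the endpoints.\<close>
  define F where "F x = integral {a..x} f" for x
  have F: "(F has_vector_derivative f x) (at x within {a..b})" if "x \<in> {a..b}" for x
    unfolding F_def using f that by (rule integral_has_vector_derivative)
  have "\<exists>C. \<forall>x\<in>{a<..<b}. y' x - F x = C"
  proof -
    have "((\<lambda>x. y' x - F x) has_vector_derivative 0) (at x within {a<..<b})"
      if "x \<in> {a<..<b}" for x
      using has_vector_derivative_diff[OF has_vector_derivative_at_within[OF y''[OF that]]
          at_open[OF that F]] that by auto
    then show ?thesis
      using has_vector_derivative_zero_constant[of "{a<..<b}" "\<lambda>x. y' x - F x"]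
      by (metis convex_real_interval(8))
  qed
  then obtain C where C: "\<And>x. x \<in> {a<..<b} \<Longrightarrow> y' x - F x = C" by blast
  define z where "z x = C + F x" for x
  have z: "(z has_vector_derivative f x) (at x within {a..b})" if "x \<in> {a..b}" for x
    unfolding z_def using has_vector_derivative_add[OF has_vector_derivative_const F[OF that]] by simp
  have zc: "continuous_on {a..b} z"
    by (rule continuous_on_vector_derivative) (rule z)
  have "(y has_vector_derivative z x) (at x within {a..b})" if x: "x \<in> {a..b}" for x
  proof -
    \<comment> \<open>\<open>y - Y\<close> has zero derivative inside and is continuous up to the
      endpoints, hence is constant on all of \<open>{a..b}\<close>; so \<open>y\<close> inherits the
      one-sided derivatives of \<open>Y\<close>.\<close>
    define Y where "Y t = integral {a..t} z" for t
    have Y: "(Y has_vector_derivative z t) (at t within {a..b})" if "t \<in> {a..b}" for t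
      unfolding Y_def using zc that by (rule integral_has_vector_derivative)
    have const: "y t = y a + Y t" if t: "t \<in> {a..b}" for t
    proof -
      have "((\<lambda>t. y t - Y t) has_derivative (\<lambda>h. 0)) (at s)" if "s \<in> {a<..<b}" for s
      proof -
        have "((\<lambda>t. y t - Y t) has_vector_derivative 0) (at s within {a<..<b})"
          using has_vector_derivative_diff[OF has_vector_derivative_at_within[OF y'[OF that]]
              at_open[OF that Y]] that C[OF that] by (auto simp: z_def algebra_simps)
        then show ?thesis
          unfolding at_within_open[OF that open_greaterThanLessThan]
          by (simp add: has_vector_derivative_def)
      qed
      moreover have "continuous_on {a..b} (\<lambda>t. y t - Y t)"
        using assms(2) Y continuous_on_vector_derivative by (intro continuous_intros) blast+
      ultimately have "y t - Y t = y a - Y a"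
        using has_derivative_zero_unique_strong_interval[of "{a, b}" a b "\<lambda>t. y t - Y t" "y a - Y a" t] t
        by (auto simp: at_within_Icc_at)
      then show ?thesis by (simp add: Y_def algebra_simps)
    qed
    have "((\<lambda>t. y a + Y t) has_vector_derivative z x) (at x within {a..b})"
      using has_vector_derivative_add[OF has_vector_derivative_const Y[OF x]] by simp
    then show ?thesis
      by (rule has_vector_derivative_transform[OF x, rotated]) (rule const)
  qed
  then show thesis using z that by blast
qed

section \<open>Energy estimate for the divergence-form equation\<close>

text \<open>Young's inequality. The free weight \<open>t\<close> serves to make the term in the
  unknown small enough to be absorbed.\<close>

lemma mult_le_weighted_squares:
  fixes a b :: real
  assumes "t > 0"
  shows "a * b \<le> t / 2 * a\<^sup>2 + b\<^sup>2 / (2 * t)"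
proof -
  have "0 \<le> (t * a - b)\<^sup>2 / (2 * t)" using assms by simp
  also have "\<dots> = t / 2 * a\<^sup>2 + b\<^sup>2 / (2 * t) - a * b"
    using assms by (simp add: power2_eq_square field_simps)
  finally show ?thesis by simp
qed

text \<open>\<open>F\<close> is the flux through the left endpoint. Testing with the conjugate of
  \<open>W\<close> turns it into an energy integral with weight \<open>V^2\<close>, so
  \<open>Re F\<close> dominates the energy; testing with a fixed function bounds \<open>F\<close> by
  half of that plus a constant. Hence \<open>E\<close> involves \<open>V\<close> only through
  \<open>M\<close> and \<delta>, and \<open>Im F\<close> is controlled by the imaginary part of the
  weight alone.\<close>

lemma divergence_form_energy:
  fixes V W W' :: "real \<Rightarrow> complex" and h M \<delta> \<mu> \<kappa> :: real
  assumes "h > 0" and "\<delta> > 0" and "M > 0"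
    and V: "continuous_on {0..h} V"
    and W: "\<And>x. x \<in> {0..h} \<Longrightarrow> (W has_vector_derivative W' x) (at x within {0..h})"
    and cW': "continuous_on {0..h} W'"
    and P: "\<And>x. x \<in> {0..h} \<Longrightarrow>
      ((\<lambda>x. (V x)\<^sup>2 * W' x) has_vector_derivative \<kappa>\<^sup>2 * ((V x)\<^sup>2 * W x)) (at x within {0..h})"
    and W0: "W 0 = 1" and Wh: "W h = 0"
    and Re_ge: "\<And>x. x \<in> {0..h} \<Longrightarrow> \<delta> \<le> Re ((V x)\<^sup>2)"
    and V_le: "\<And>x. x \<in> {0..h} \<Longrightarrow> cmod (V x) \<le> M"
    and Im_le: "\<And>x. x \<in> {0..h} \<Longrightarrow> \<bar>Im ((V x)\<^sup>2)\<bar> \<le> \<mu>"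
  defines "F \<equiv> - ((V 0)\<^sup>2 * W' 0)"
    and "E \<equiv> M^4 / \<delta>\<^sup>2 * (h * (1 / h\<^sup>2 + \<kappa>\<^sup>2))"
  shows "cmod F \<le> M\<^sup>2 * E" and "\<bar>Im F\<bar> \<le> \<mu> * E"
proof -
  have cW: "continuous_on {0..h} W" by (rule continuous_on_vector_derivative) (rule W)
  define e where "e x = (cmod (W' x))\<^sup>2 + \<kappa>\<^sup>2 * (cmod (W x))\<^sup>2" for x
  define J where "J = integral {0..h} e"
  have ce: "continuous_on {0..h} e" unfolding e_def using cW cW' by (intro continuous_intros)
  have J: "(e has_integral J) {0..h}"
    unfolding J_def by (intro integrable_integral integrable_continuous_interval ce)
  have e0: "e x \<ge> 0" for x by (simp add: e_def)
  have J0: "J \<ge> 0" using has_integral_nonneg[OF J] e0 by blast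
  \<comment> \<open>Weak form: the boundary term at \<open>h\<close> vanishes with the test
    function, and the one at \<open>0\<close> is exactly \<open>F\<close> because the test function
    equals 1 there.\<close>
  have weak: "((\<lambda>x. (V x)\<^sup>2 * (W' x * \<phi>' x + \<kappa>\<^sup>2 * (W x * \<phi> x))) has_integral F) {0..h}"
    if \<phi>: "\<And>x. x \<in> {0..h} \<Longrightarrow> (\<phi> has_vector_derivative \<phi>' x) (at x within {0..h})"
      and b: "\<phi> 0 = 1" "\<phi> h = 0" for \<phi> \<phi>'
  proof -
    have "((\<lambda>x. (V x)\<^sup>2 * W' x * \<phi> x) has_vector_derivative
        (V x)\<^sup>2 * (W' x * \<phi>' x + \<kappa>\<^sup>2 * (W x * \<phi> x))) (at x within {0..h})" if "x \<in> {0..h}" for x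
      using has_vector_derivative_mult[OF P[OF that] \<phi>[OF that]] by (simp add: algebra_simps)
    from fundamental_theorem_of_calculus[OF less_imp_le[OF \<open>h > 0\<close>] this]
    show ?thesis by (simp add: b F_def)
  qed
  \<comment> \<open>The conjugate of \<open>W\<close> is an admissible test function, having the
    same boundary values 1 and 0.\<close>
  have FJ: "((\<lambda>x. (V x)\<^sup>2 * of_real (e x)) has_integral F) {0..h}"
  proof -
    have "((\<lambda>x. cnj (W x)) has_vector_derivative cnj (W' x)) (at x within {0..h})"
      if "x \<in> {0..h}" for x
      using W[OF that] by (rule has_vector_derivative_cnj)
    from weak[OF this] have "((\<lambda>x. (V x)\<^sup>2 * (W' x * cnj (W' x) + \<kappa>\<^sup>2 * (W x * cnj (W x))))
        has_integral F) {0..h}" using W0 Wh by simp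
    then show ?thesis by (simp add: e_def complex_norm_square flip: of_real_power)
  qed
  have ReF: "\<delta> * J \<le> Re F"
  proof (rule has_integral_le)
    show "((\<lambda>x. \<delta> * e x) has_integral \<delta> * J) {0..h}" using J by (rule has_integral_mult_right)
    show "((\<lambda>x. Re ((V x)\<^sup>2 * of_real (e x))) has_integral Re F) {0..h}"
      using has_integral_Re[OF FJ] by simp
  qed (use Re_ge e0 in \<open>auto intro: mult_right_mono\<close>)
  have bound: "cmod F \<le> integral {0..h} b"
    if "(u has_integral F) {0..h}" "b integrable_on {0..h}"
      "\<And>x. x \<in> {0..h} \<Longrightarrow> cmod (u x) \<le> b x" for u b
    using integral_norm_bound_integral[of u "{0..h}" b] that
    by (metis integral_unique has_integral_integrable)
  have V2: "cmod ((V x)\<^sup>2) \<le> M\<^sup>2" if "x \<in> {0..h}" for x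
    using V_le[OF that] by (simp add: norm_power power_mono)
  have JE: "J \<le> E"
  proof -
    define \<phi> where "\<phi> x = (1 - x / h)" for x
    have \<phi>d: "((\<lambda>x. complex_of_real (\<phi> x)) has_vector_derivative of_real (- 1 / h))
        (at x within {0..h})" for x
      unfolding \<phi>_def
      by (rule has_vector_derivative_of_real) (use \<open>h > 0\<close> in \<open>auto intro!: derivative_eq_intros\<close>)
    have \<phi>F: "((\<lambda>x. (V x)\<^sup>2 * (W' x * of_real (-1/h) + \<kappa>\<^sup>2 * (W x * of_real (\<phi> x)))) has_integral F) {0..h}"
      by (rule weak[OF \<phi>d]) (use \<open>h > 0\<close> in \<open>auto simp: \<phi>_def\<close>)
    \<comment> \<open>With this weight the bound \<open>M^2\<close> on the coefficient turns
      \<open>t / 2\<close> into \<delta>\<open>/ 2\<close>, half of the coercivity constant.\<close>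
    define t where "t = \<delta> / M\<^sup>2"
    have t: "t > 0" using assms by (simp add: t_def)
    define q where "q = 1 / h\<^sup>2 + \<kappa>\<^sup>2"
    have "cmod ((V x)\<^sup>2 * (W' x * of_real (-1/h) + \<kappa>\<^sup>2 * (W x * of_real (\<phi> x))))
        \<le> \<delta> / 2 * e x + M^4 / (2 * \<delta>) * q" if x: "x \<in> {0..h}" for x
    proof -
      have \<phi>1: "0 \<le> \<phi> x" "\<phi> x \<le> 1" using x \<open>h > 0\<close> by (auto simp: \<phi>_def)
      have "cmod (W' x * of_real (-1/h) + \<kappa>\<^sup>2 * (W x * of_real (\<phi> x)))
          \<le> cmod (W' x * of_real (-1/h)) + cmod (\<kappa>\<^sup>2 * (W x * of_real (\<phi> x)))"
        by (rule norm_triangle_ineq)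
      also have "\<dots> = cmod (W' x) * (1/h) + \<kappa>\<^sup>2 * (cmod (W x) * \<phi> x)"
        using \<phi>1 \<open>h > 0\<close> by (simp add: norm_mult norm_divide norm_power)
      also have "\<dots> \<le> (t/2 * (cmod (W' x))\<^sup>2 + (1/h)\<^sup>2 / (2*t))
            + \<kappa>\<^sup>2 * (t/2 * (cmod (W x))\<^sup>2 + 1 / (2*t))"
      proof -
        have "cmod (W x) * \<phi> x \<le> cmod (W x) * 1" using \<phi>1 by (intro mult_left_mono) auto
        also have "\<dots> \<le> t/2 * (cmod (W x))\<^sup>2 + 1\<^sup>2 / (2*t)" by (rule mult_le_weighted_squares[OF t])
        finally have "cmod (W x) * \<phi> x \<le> t/2 * (cmod (W x))\<^sup>2 + 1 / (2*t)" by simp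
        then show ?thesis
          using mult_le_weighted_squares[OF t, of "cmod (W' x)" "1/h"]
          by (intro add_mono mult_left_mono) auto
      qed
      also have "\<dots> = t / 2 * e x + q / (2 * t)"
        using t by (simp add: e_def q_def field_simps)
      finally have *: "cmod (W' x * of_real (-1/h) + \<kappa>\<^sup>2 * (W x * of_real (\<phi> x)))
          \<le> t / 2 * e x + q / (2 * t)" .
      have "cmod ((V x)\<^sup>2 * (W' x * of_real (-1/h) + \<kappa>\<^sup>2 * (W x * of_real (\<phi> x))))
          \<le> M\<^sup>2 * (t / 2 * e x + q / (2 * t))"
        unfolding norm_mult[of "(V x)\<^sup>2"] by (intro mult_mono V2 x *) auto
      also have "\<dots> = \<delta> / 2 * e x + M^4 / (2 * \<delta>) * q"
        using assms(2,3) by (simp add: t_def field_simps power2_eq_square power4_eq_xxxx)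
      finally show ?thesis .
    qed
    moreover have int: "((\<lambda>x. \<delta> / 2 * e x + M^4 / (2 * \<delta>) * q) has_integral
        \<delta> / 2 * J + M^4 / (2 * \<delta>) * q * h) {0..h}"
      using has_integral_add[OF has_integral_mult_right[OF J, of "\<delta> / 2"]
          has_integral_const_real[of "M^4 / (2 * \<delta>) * q" 0 h]] \<open>h > 0\<close> by (simp add: mult_ac)
    ultimately have "cmod F \<le> \<delta> / 2 * J + M^4 / (2 * \<delta>) * q * h"
      using bound[OF \<phi>F has_integral_integrable[OF int]] integral_unique[OF int] by simp
    \<comment> \<open>Absorption: \<delta>\<open>* J\<close> \<le> \<open>Re F\<close> \<le>
      \<open>cmod F\<close>, and half of the left side cancels the energy term on the right.\<close>
    with ReF complex_Re_le_cmod[of F] have "\<delta> / 2 * J \<le> M^4 / (2 * \<delta>) * q * h" by linarith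
    then show ?thesis
      using \<open>\<delta> > 0\<close> unfolding E_def q_def[symmetric]
      by (simp add: field_simps power2_eq_square)
  qed
  have MJ: "((\<lambda>x. M\<^sup>2 * e x) has_integral M\<^sup>2 * J) {0..h}" using J by (rule has_integral_mult_right)
  have "cmod F \<le> M\<^sup>2 * J"
    using bound[OF FJ has_integral_integrable[OF MJ]] V2 e0
    unfolding integral_unique[OF MJ] by (simp add: norm_mult mult_right_mono)
  also have "\<dots> \<le> M\<^sup>2 * E" using JE by (simp add: mult_left_mono)
  finally show "cmod F \<le> M\<^sup>2 * E" .
  have \<mu>0: "\<mu> \<ge> 0" using Im_le[of 0] \<open>h > 0\<close> by auto
  have mJ: "((\<lambda>x. \<mu> * e x) has_integral \<mu> * J) {0..h}" using J by (rule has_integral_mult_right)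
  \<comment> \<open>The energy density \<open>e\<close> is real, so only the imaginary part of the
    weight contributes.\<close>
  have ImF: "((\<lambda>x. Im ((V x)\<^sup>2 * of_real (e x))) has_integral Im F) {0..h}"
    using has_integral_Im[OF FJ] by simp
  have "norm (integral {0..h} (\<lambda>x. Im ((V x)\<^sup>2 * of_real (e x)))) \<le> integral {0..h} (\<lambda>x. \<mu> * e x)"
    by (rule integral_norm_bound_integral)
      (use ImF mJ Im_le e0 in \<open>auto simp: abs_mult intro!: mult_right_mono\<close>)
  then have "\<bar>Im F\<bar> \<le> \<mu> * J" unfolding integral_unique[OF ImF] integral_unique[OF mJ] by simp
  also have "\<dots> \<le> \<mu> * E" using JE \<mu>0 by (simp add: mult_left_mono)
  finally show "\<bar>Im F\<bar> \<le> \<mu> * E" .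
qed

section \<open>From the Rayleigh equation to the energy estimate\<close>

text \<open>Dividing \<open>y\<close> by \<open>U - c\<close> removes \<open>U''\<close> from the
  equation, and \<open>F\<close> becomes the flux of the quotient at \<open>0\<close>. The explicit
  factor \<open>Im c\<close> in the second bound is what later allows division by it.\<close>

lemma rayleigh_boundary_term_bounds:
  fixes U :: "real \<Rightarrow> real" and c :: complex and h M d :: real and k :: int
  assumes "h > 0" and "d > 0" and "M > 0" and U: "C2_on {0..h} U" and y: "rayleigh_bvp h k U c y"
    and lower: "\<And>x. x \<in> {0..h} \<Longrightarrow> 3/4 * d \<le> \<bar>U x - Re c\<bar>"
    and upper: "\<And>x. x \<in> {0..h} \<Longrightarrow> cmod (of_real (U x) - c) \<le> M"
    and imag: "\<bar>Im c\<bar> \<le> d/4"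
  defines "F \<equiv> - (of_real (U 0) - c)\<^sup>2 * D {0..h} y 0 + of_real (D {0..h} U 0) * (of_real (U 0) - c)"
    and "E \<equiv> M^4 / (d\<^sup>2 / 2)\<^sup>2 * (h * (1 / h\<^sup>2 + (real_of_int k)\<^sup>2))"
  shows "cmod F \<le> M\<^sup>2 * E" and "\<bar>Im F\<bar> \<le> 2 * M * \<bar>Im c\<bar> * E"
proof -
  define V where "V x = complex_of_real (U x) - c" for x
  define U1 where "U1 = D {0..h} U"
  define U2 where "U2 = D {0..h} U1"
  have Ud: "(U has_vector_derivative U1 x) (at x within {0..h})" if "x \<in> {0..h}" for x
    using U that unfolding C2_on_def U1_def D_def differentiable_on_def
    by (auto simp flip: vector_derivative_works)
  have U1d: "(U1 has_vector_derivative U2 x) (at x within {0..h})" if "x \<in> {0..h}" for x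
    using U that unfolding C2_on_def U1_def[symmetric] U2_def differentiable_on_def
    by (auto simp: D_def simp flip: vector_derivative_works)
  have U2c: "continuous_on {0..h} U2" using U by (simp add: C2_on_def U1_def U2_def)
  have Uc: "continuous_on {0..h} U" by (rule continuous_on_vector_derivative) (rule Ud)
  have Vd: "(V has_vector_derivative of_real (U1 x)) (at x within {0..h})" if "x \<in> {0..h}" for x
    using has_vector_derivative_diff[OF has_vector_derivative_of_real[OF
          Ud[OF that, folded has_real_derivative_iff_has_vector_derivative]]
        has_vector_derivative_const[of c]] by (simp add: V_def[abs_def])
  have Vc: "continuous_on {0..h} V" by (rule continuous_on_vector_derivative) (rule Vd)
  have V0: "V x \<noteq> 0" if "x \<in> {0..h}" for x
    using lower[OF that] \<open>d > 0\<close> by (auto simp: V_def)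
  define f where "f x = (of_real (U2 x) / V x + of_int k ^ 2) * y x" for x
  have yc: "continuous_on {0..h} y" and yh: "y h = 0" and y0: "y 0 = 1"
    and y2: "C2_on {0<..<h} y"
    and ode: "\<And>x. x \<in> {0<..<h} \<Longrightarrow> D {0<..<h} (D {0<..<h} y) x = f x"
    using y by (auto simp: rayleigh_bvp_def f_def V_def U1_def U2_def)
  have fc: "continuous_on {0..h} f"
    unfolding f_def using V0 by (intro continuous_intros U2c Vc yc) auto
  have "(y has_vector_derivative D {0<..<h} y x) (at x)" if "x \<in> {0<..<h}" for x
    using y2 that unfolding C2_on_def D_def differentiable_on_def
    by (metis at_within_open open_greaterThanLessThan vector_derivative_works)
  moreover have "(D {0<..<h} y has_vector_derivative f x) (at x)" if "x \<in> {0<..<h}" for x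
  proof -
    have "D {0<..<h} y differentiable (at x within {0<..<h})"
      using y2 that by (auto simp: C2_on_def differentiable_on_def)
    then have "(D {0<..<h} y has_vector_derivative D {0<..<h} (D {0<..<h} y) x) (at x within {0<..<h})"
      by (simp add: vector_derivative_works D_def[of _ "D {0<..<h} y"])
    then show ?thesis
      using that ode by (metis at_within_open open_greaterThanLessThan)
  qed
  ultimately obtain z where
    yd: "\<And>x. x \<in> {0..h} \<Longrightarrow> (y has_vector_derivative z x) (at x within {0..h})" and
    zd: "\<And>x. x \<in> {0..h} \<Longrightarrow> (z has_vector_derivative f x) (at x within {0..h})"
    using derivatives_extend_to_closed_interval[OF \<open>h > 0\<close> yc fc] by blast
  have zc: "continuous_on {0..h} z" by (rule continuous_on_vector_derivative) (rule zd)
  \<comment> \<open>Identifies the one-sided derivative in the interface condition with the value at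
    \<open>0\<close> of the extended derivative.\<close>
  have z0: "D {0..h} y 0 = z 0"
    unfolding D_def using yd[of 0] \<open>h > 0\<close>
    by (intro vector_derivative_within_cbox[of 0 h, unfolded cbox_interval]) auto
  define W where "W x = V 0 * y x / V x" for x
  \<comment> \<open>Over this common denominator, \<open>V^2 * W'\<close> is \<open>V 0\<close>
    times the Wronskian-type expression \<open>V * z - U1 * y\<close>, which can be differentiated
    without quotients.\<close>
  define W' where "W' x = V 0 * (V x * z x - of_real (U1 x) * y x) / (V x)\<^sup>2" for x
  have U1c: "continuous_on {0..h} U1" by (rule continuous_on_vector_derivative) (rule U1d)
  have Wd: "(W has_vector_derivative W' x) (at x within {0..h})" if x: "x \<in> {0..h}" for x
  proof -
    have "((\<lambda>x. inverse (V x)) has_vector_derivative - (inverse (V x) * of_real (U1 x) * inverse (V x)))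
        (at x within {0..h})"
      using Deriv.has_derivative_inverse[where f = V, OF V0[OF x] Vd[OF x, unfolded has_vector_derivative_def]]
      by (auto simp: has_vector_derivative_def scaleR_conv_of_real algebra_simps)
    from has_vector_derivative_mult[OF yd[OF x] this]
    have "((\<lambda>x. V 0 * (y x * inverse (V x))) has_vector_derivative V 0 *
        (y x * - (inverse (V x) * of_real (U1 x) * inverse (V x)) + z x * inverse (V x))) (at x within {0..h})"
      by (rule has_vector_derivative_mult_right)
    moreover have "V 0 * (y x * - (inverse (V x) * of_real (U1 x) * inverse (V x)) + z x * inverse (V x)) = W' x"
      using V0[OF x] by (simp add: W'_def field_simps power2_eq_square)
    moreover have "(\<lambda>x. V 0 * (y x * inverse (V x))) = W" by (simp add: W_def fun_eq_iff divide_inverse)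
    ultimately show ?thesis by simp
  qed
  have W'c: "continuous_on {0..h} W'"
    unfolding W'_def using V0 by (intro continuous_intros Vc zc U1c yc) auto
  have Pd: "((\<lambda>x. (V x)\<^sup>2 * W' x) has_vector_derivative
      complex_of_real ((real_of_int k)\<^sup>2) * ((V x)\<^sup>2 * W x)) (at x within {0..h})" if x: "x \<in> {0..h}" for x
  proof -
    have "((\<lambda>x. V 0 * (V x * z x - of_real (U1 x) * y x)) has_vector_derivative
        V 0 * ((V x * f x + of_real (U1 x) * z x) - (of_real (U1 x) * z x + of_real (U2 x) * y x)))
        (at x within {0..h})"
      by (intro has_vector_derivative_mult_right has_vector_derivative_diff has_vector_derivative_mult
          has_vector_derivative_of_real Vd zd yd x
          U1d[folded has_real_derivative_iff_has_vector_derivative])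
    \<comment> \<open>The first-order terms cancel, and \<open>V * f\<close> =
      \<open>U2 * y + k^2 * V * y\<close> cancels the term with \<open>U2\<close>.\<close>
    moreover have "V 0 * ((V x * f x + of_real (U1 x) * z x) - (of_real (U1 x) * z x + of_real (U2 x) * y x))
        = complex_of_real ((real_of_int k)\<^sup>2) * ((V x)\<^sup>2 * W x)"
      using V0[OF x] by (simp add: f_def W_def field_simps power2_eq_square)
    ultimately have "((\<lambda>x. V 0 * (V x * z x - of_real (U1 x) * y x)) has_vector_derivative
        complex_of_real ((real_of_int k)\<^sup>2) * ((V x)\<^sup>2 * W x)) (at x within {0..h})" by simp
    then show ?thesis
      by (rule has_vector_derivative_transform[OF x, rotated]) (use V0 in \<open>simp add: W'_def\<close>)
  qed
  \<comment> \<open>The constant is \<open>(3/4)^2 - (1/4)^2 = 1/2\<close>.\<close>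
  have ReV: "d\<^sup>2 / 2 \<le> Re ((V x)\<^sup>2)" if "x \<in> {0..h}" for x
  proof -
    have "(3/4 * d)\<^sup>2 \<le> \<bar>U x - Re c\<bar>\<^sup>2" using lower[OF that] \<open>d > 0\<close> by (intro power_mono) auto
    moreover have "\<bar>Im c\<bar>\<^sup>2 \<le> (d/4)\<^sup>2" using imag by (intro power_mono) auto
    moreover have "Re ((V x)\<^sup>2) = \<bar>U x - Re c\<bar>\<^sup>2 - \<bar>Im c\<bar>\<^sup>2" by (simp add: V_def power2_eq_square)
    ultimately show ?thesis by (simp add: power_mult_distrib power_divide)
  qed
  have ImV: "\<bar>Im ((V x)\<^sup>2)\<bar> \<le> 2 * M * \<bar>Im c\<bar>" if "x \<in> {0..h}" for x
  proof -
    have "\<bar>U x - Re c\<bar> \<le> M"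
      using upper[OF that] abs_Re_le_cmod[of "of_real (U x) - c"] by simp
    moreover have "Im ((V x)\<^sup>2) = - (2 * (U x - Re c) * Im c)"
      by (simp add: V_def Im_power2)
    then have "\<bar>Im ((V x)\<^sup>2)\<bar> = 2 * \<bar>U x - Re c\<bar> * \<bar>Im c\<bar>"
      by (simp only: abs_minus_cancel abs_mult abs_numeral)
    ultimately show ?thesis by (simp add: mult_right_mono)
  qed
  have W0: "W 0 = 1" using V0[of 0] \<open>h > 0\<close> by (simp add: W_def y0)
  have Wh: "W h = 0" by (simp add: W_def yh)
  have F: "F = - ((V 0)\<^sup>2 * W' 0)"
    using V0[of 0] \<open>h > 0\<close> unfolding F_def z0 U1_def[symmetric] V_def[symmetric]
    by (simp add: W'_def y0 field_simps power2_eq_square)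
  have "d\<^sup>2 / 2 > 0" using \<open>d > 0\<close> by simp
  note energy = divergence_form_energy[OF \<open>h > 0\<close> this \<open>M > 0\<close> Vc Wd W'c Pd W0 Wh ReV
      upper[folded V_def] ImV]
  show "cmod F \<le> M\<^sup>2 * E" using energy(1) unfolding F E_def by simp
  show "\<bar>Im F\<bar> \<le> 2 * M * \<bar>Im c\<bar> * E" using energy(2) unfolding F E_def by simp
qed

section \<open>Reality of roots of the perturbed dispersion relation\<close>

text \<open>The real part forces \<open>2 * K\<close> times the modulus of \<open>Re c\<close> to be
  at least \<open>sqrt (2 * G * K)\<close>. If \<open>Im c\<close> were nonzero, it could be divided
  out of the imaginary part, making the same quantity at most \<epsilon>\<open>* (B' + A0)\<close>,
  which \<open>small2\<close> excludes.\<close>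

lemma dispersion_perturbation_real:
  fixes c F :: complex and A G K :: real
  assumes eq: "of_real (G - g * \<epsilon>) = of_real \<epsilon> * F + c\<^sup>2 * of_real K + of_real \<epsilon> * c * of_real A"
    and "K > 0" and "G > 0" and "g > 0" and "\<epsilon> > 0"
    and F: "cmod F \<le> B" and ImF: "\<bar>Im F\<bar> \<le> B' * \<bar>Im c\<bar>" and A: "\<bar>A\<bar> \<le> A0" and c: "cmod c \<le> M"
    and "B' \<ge> 0"
    and small1: "\<epsilon> * (2 * (g + B + M * A0)) \<le> G"
    and small2: "\<epsilon> * (B' + A0 + 1) \<le> sqrt (2 * G * K)"
  shows "c \<in> \<real>"
proof (rule ccontr)
  assume "c \<notin> \<real>"
  then have ci: "\<bar>Im c\<bar> > 0" by (simp add: complex_is_Real_iff)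
  have re: "G - g * \<epsilon> = \<epsilon> * Re F + ((Re c)\<^sup>2 - (Im c)\<^sup>2) * K + \<epsilon> * (Re c * A)"
    using arg_cong[OF eq, of Re] by (simp add: power2_eq_square algebra_simps)
  have im: "0 = \<epsilon> * Im F + 2 * Re c * Im c * K + \<epsilon> * (Im c * A)"
    using arg_cong[OF eq, of Im] by (simp add: power2_eq_square algebra_simps)
  have "\<bar>Re c * A\<bar> \<le> M * A0"
    unfolding abs_mult using abs_Re_le_cmod[of c] c A by (intro mult_mono) auto
  moreover have "Re F \<le> B" using complex_Re_le_cmod[of F] F by simp
  ultimately have "\<epsilon> * (g + Re F + Re c * A) \<le> \<epsilon> * (g + B + M * A0)"
    using \<open>\<epsilon> > 0\<close> by (intro mult_left_mono) auto
  \<comment> \<open>By \<open>small1\<close> the perturbation uses up at most half of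
    \<open>G\<close>.\<close>
  then have "G / 2 \<le> ((Re c)\<^sup>2 - (Im c)\<^sup>2) * K"
    using re small1 by (simp add: algebra_simps)
  also have "\<dots> \<le> (Re c)\<^sup>2 * K" using \<open>K > 0\<close> by (intro mult_right_mono) auto
  finally have "2 * G \<le> 4 * ((Re c)\<^sup>2 * K)" by linarith
  then have "2 * G * K \<le> 4 * ((Re c)\<^sup>2 * K) * K" using \<open>K > 0\<close> by (intro mult_right_mono) auto
  also have "\<dots> = (2 * \<bar>Re c\<bar> * K)\<^sup>2" by (simp add: power2_eq_square)
  finally have lower: "sqrt (2 * G * K) \<le> 2 * \<bar>Re c\<bar> * K"
    using \<open>K > 0\<close> by (simp add: real_le_lsqrt)
  have "2 * \<bar>Re c\<bar> * K * \<bar>Im c\<bar> = \<bar>2 * Re c * Im c * K\<bar>" using \<open>K > 0\<close> by (simp add: abs_mult)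
  also have "\<dots> = \<bar>\<epsilon> * (Im F + Im c * A)\<bar>" using im by (simp add: algebra_simps)
  also have "\<dots> = \<epsilon> * \<bar>Im F + Im c * A\<bar>" using \<open>\<epsilon> > 0\<close> by (simp add: abs_mult)
  also have "\<dots> \<le> \<epsilon> * (B' * \<bar>Im c\<bar> + \<bar>Im c\<bar> * A0)"
  proof -
    have "\<bar>Im c * A\<bar> \<le> \<bar>Im c\<bar> * A0" using A by (simp add: abs_mult mult_left_mono)
    then show ?thesis using ImF \<open>\<epsilon> > 0\<close> by (intro mult_left_mono) auto
  qed
  also have "\<dots> = \<epsilon> * (B' + A0) * \<bar>Im c\<bar>" by (simp add: algebra_simps)
  finally have "2 * \<bar>Re c\<bar> * K \<le> \<epsilon> * (B' + A0)" using ci by simp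
  \<comment> \<open>The summand 1 in \<open>small2\<close> makes the contradiction strict.\<close>
  with lower small2 \<open>\<epsilon> > 0\<close> show False by (simp add: algebra_simps)
qed

section \<open>Uniform constants and choice of the threshold\<close>

theorem lemma3p1:
  fixes g \<sigma> rhom hm hp ck :: real and k :: int and U :: "real \<Rightarrow> real"
  assumes "g > 0" and "\<sigma> \<ge> 0" and "rhom > 0" and "hm > 0" and "hp > 0" and "k \<noteq> 0"
    and "C2_on {0..hp} U"
    and "ck = sqrt ((g + \<sigma> * (real_of_int k)\<^sup>2 / rhom)
                      / (\<bar>real_of_int k\<bar> * tanh (\<bar>real_of_int k\<bar> * hm)))
       \<or> ck = - sqrt ((g + \<sigma> * (real_of_int k)\<^sup>2 / rhom)
                      / (\<bar>real_of_int k\<bar> * tanh (\<bar>real_of_int k\<bar> * hm)))"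
    and "ck \<notin> U ` {0..hp}"
  shows "\<exists>\<epsilon>k>0. \<forall>\<epsilon>\<in>{0<..<\<epsilon>k}. \<forall>(c::complex) (y::real \<Rightarrow> complex).
           rayleigh_bvp hp k U c y \<longrightarrow>
           interface_condition g \<sigma> rhom hm hp k U \<epsilon> c y \<longrightarrow>
           cmod (c - of_real ck) \<le> (1/4) * (INF x\<in>{0..hp}. \<bar>ck - U x\<bar>) \<longrightarrow>
           c \<in> \<real>"
proof -
  define \<kappa> where "\<kappa> = \<bar>real_of_int k\<bar>"
  define T where "T = tanh (\<kappa> * hm)"
  define Tp where "Tp = tanh (\<kappa> * hp)"
  define G where "G = g + \<sigma> * \<kappa>\<^sup>2 / rhom"
  define d where "d = (INF x\<in>{0..hp}. \<bar>ck - U x\<bar>)"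
  have \<kappa>: "\<kappa> > 0" using assms by (simp add: \<kappa>_def)
  have T: "T > 0" and Tp: "Tp > 0" using \<kappa> assms by (auto simp: T_def Tp_def)
  have T1: "T < 1" by (simp add: T_def tanh_real_lt_1)
  have G: "G > 0" using assms by (simp add: G_def add_pos_nonneg)
  have Uc: "continuous_on {0..hp} U"
    using assms(7) by (auto simp: C2_on_def differentiable_imp_continuous_on)
  have d_le: "d \<le> \<bar>ck - U x\<bar>" if "x \<in> {0..hp}" for x
    unfolding d_def using that by (intro cINF_lower bdd_belowI2[of _ 0]) auto
  \<comment> \<open>By compactness the distance from \<open>ck\<close> to the range of
    \<open>U\<close> is attained, and it is nonzero since \<open>ck\<close> lies outside that
    range.\<close>
  have d0: "d > 0"
  proof -
    have "continuous_on {0..hp} (\<lambda>x. \<bar>ck - U x\<bar>)" by (intro continuous_intros Uc)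
    then obtain x0 where x0: "x0 \<in> {0..hp}" "\<And>x. x \<in> {0..hp} \<Longrightarrow> \<bar>ck - U x0\<bar> \<le> \<bar>ck - U x\<bar>"
      using continuous_attains_inf[of "{0..hp}" "\<lambda>x. \<bar>ck - U x\<bar>"] assms by auto
    have "\<bar>ck - U x0\<bar> \<le> d" unfolding d_def using x0 assms by (intro cINF_greatest) auto
    moreover have "\<bar>ck - U x0\<bar> > 0" using x0(1) assms(9) by auto
    ultimately show ?thesis by simp
  qed
  obtain B where B: "\<And>x. x \<in> {0..hp} \<Longrightarrow> \<bar>U x\<bar> \<le> B"
    using compact_imp_bounded[OF compact_continuous_image[OF Uc]]
    unfolding bounded_iff by (metis compact_Icc imageI real_norm_def)
  have B0: "B \<ge> 0" using B[of 0] assms by auto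
  \<comment> \<open>Large enough to bound both \<open>c\<close> and \<open>U - c\<close> for every
    \<open>c\<close> within \<open>d / 4\<close> of \<open>ck\<close>.\<close>
  define M where "M = B + \<bar>ck\<bar> + d"
  have M: "M > 0" using B0 d0 by (simp add: M_def)
  define E where "E = M^4 / (d\<^sup>2 / 2)\<^sup>2 * (hp * (1 / hp\<^sup>2 + (real_of_int k)\<^sup>2))"
  have E: "E \<ge> 0" using assms by (simp add: E_def)
  \<comment> \<open>Bounds the coefficient of \<epsilon>\<open>* c\<close> uniformly in \<epsilon>:
    the positive summand \<epsilon>\<open>* T\<close> is dropped from the denominator and
    \<open>1 - T^2\<close> is replaced by 1.\<close>
  define A0 where "A0 = \<kappa> * \<bar>U 0\<bar> / Tp"
  have A0: "A0 \<ge> 0" using \<kappa> Tp by (simp add: A0_def)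
  define N where "N = 2 * (g + M\<^sup>2 * E + M * A0)"
  define N' where "N' = 2 * M * E + A0 + 1"
  have N: "N > 0" and N': "N' > 0" using assms M E A0 by (auto simp: N_def N'_def add_pos_nonneg add_nonneg_pos)
  \<comment> \<open>The two quotients are exactly the smallness conditions for the real and the
    imaginary part; neither depends on \<open>c\<close>, \<open>y\<close> or \<epsilon>.\<close>
  define \<epsilon>k where "\<epsilon>k = min (G / N) (sqrt (2 * G * (\<kappa> * T)) / N')"
  have \<epsilon>k: "\<epsilon>k > 0" using G N N' \<kappa> T by (simp add: \<epsilon>k_def)
  have "c \<in> \<real>" if \<epsilon>: "\<epsilon> \<in> {0<..<\<epsilon>k}" and y: "rayleigh_bvp hp k U c y"
      and ic: "interface_condition g \<sigma> rhom hm hp k U \<epsilon> c y" and cd: "cmod (c - of_real ck) \<le> d / 4"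
    for \<epsilon> c y
  proof -
    have near: "\<bar>Re c - ck\<bar> \<le> d / 4" "\<bar>Im c\<bar> \<le> d / 4"
      using abs_Re_le_cmod[of "c - of_real ck"] abs_Im_le_cmod[of "c - of_real ck"] cd by auto
    have cM: "cmod c \<le> \<bar>ck\<bar> + d"
      using norm_triangle_sub[of c "of_real ck"] cd d0 by simp
    have lower: "3/4 * d \<le> \<bar>U x - Re c\<bar>" if "x \<in> {0..hp}" for x
      using d_le[OF that] near(1) by linarith
    have upper: "cmod (of_real (U x) - c) \<le> M" if "x \<in> {0..hp}" for x
      using norm_triangle_ineq4[of "of_real (U x)" c] cM B[OF that] by (simp add: M_def)
    define F where "F = - (of_real (U 0) - c)\<^sup>2 * D {0..hp} y 0
        + of_real (D {0..hp} U 0) * (of_real (U 0) - c)"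
    note Fb = rayleigh_boundary_term_bounds[OF \<open>hp > 0\<close> d0 M \<open>C2_on {0..hp} U\<close> y lower upper near(2),
        folded E_def F_def]
    define A where "A = \<kappa> * U 0 * (1 - T\<^sup>2) / (Tp + \<epsilon> * T)"
    have A: "\<bar>A\<bar> \<le> A0"
    proof -
      have "T\<^sup>2 \<le> 1" using T T1 by (simp add: power_le_one)
      then have "\<bar>1 - T\<^sup>2\<bar> \<le> 1" by simp
      then have "\<kappa> * \<bar>U 0\<bar> * \<bar>1 - T\<^sup>2\<bar> \<le> \<kappa> * \<bar>U 0\<bar> * 1" using \<kappa> by (intro mult_left_mono) auto
      then show ?thesis
        unfolding A_def A0_def abs_divide abs_mult using \<kappa> T Tp \<epsilon> by (intro frac_le) auto
    qed
    \<comment> \<open>The terms with \<open>y'(0)\<close> and \<open>U'(0)\<close> are grouped into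
      \<epsilon>\<open>* F\<close>; the remaining coefficient \<open>A\<close> is real.\<close>
    have "of_real (G - g * \<epsilon>) = of_real \<epsilon> * F + c\<^sup>2 * of_real (\<kappa> * T) + of_real \<epsilon> * c * of_real A"
      using ic unfolding interface_condition_def Let_def \<kappa>_def[symmetric] T_def[symmetric]
        Tp_def[symmetric] F_def A_def G_def
      by (simp add: algebra_simps)
    moreover have "\<epsilon> * N \<le> G" "\<epsilon> * N' \<le> sqrt (2 * G * (\<kappa> * T))"
      using \<epsilon> N N' by (auto simp: \<epsilon>k_def pos_less_divide_eq less_imp_le)
    ultimately show "c \<in> \<real>"
      using dispersion_perturbation_real[of G g \<epsilon> F c "\<kappa> * T" A "M\<^sup>2 * E" "2 * M * E" A0 M]
        \<kappa> T G \<open>g > 0\<close> \<epsilon> Fb A cM B0 M E by (simp add: N_def N'_def M_def mult_ac)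
  qed
  then show ?thesis using \<epsilon>k unfolding d_def by (intro exI[of _ \<epsilon>k]) auto
qed

end
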